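(* Let $k\ge 1$ and $m\ge 1$ be integers, and let $\mathcal{H}=(H_1,\ldots,H_m)$, where each $H_i$ is a finite nonempty $k$-uniform hypergraph on the common vertex set $V$. Let $H=\dot{\bigcup}_{j\in[m]}H_j$ be the multihypergraph that is the union of the $H_j$ counted with multiplicity. If $|H_i|\ge k\,\Delta(H)$ for every $i\in[m]$, then $(H_1,\ldots,H_m)$ has a system of disjoint representatives (SJR).
   Context: $[m]=\{1,\ldots,m\}$. A hypergraph is identified with its set of edges (nonempty subsets of the vertex set); it is $k$-uniform if every edge has exactly $k$ vertices; $|H_i|$ is the number of edges of $H_i$. In the multiset union $\dot{\bigcup}_{j\in[m]}H_j$, an edge belonging to several of the $H_j$ appears once for each such $j$. For a multihypergraph $H$ and a vertex $v$, $deg_H(v)$ is the number of edges of $H$ (counted with multiplicity) containing $v$, and $\Delta(H)=\max_v deg_H(v)$. An SJR of $(H_1,\ldots,H_m)$ is a function $f:[m]\to\bigcup_{i\in[m]}H_i$ with $f(i)\in H_i$ for all $i$ and $f(i)\cap f(j)=\emptyset$ whenever $i\ne j$. *)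

theory Defs
  imports "HOL-Library.Multiset" "HOL-Library.FuncSet"
begin

definition hypergraph :: "'a set \<Rightarrow> 'a set set \<Rightarrow> bool" where
  "hypergraph V E \<longleftrightarrow> (\<forall>e\<in>E. e \<subseteq> V \<and> e \<noteq> {})"

definition uniform :: "nat \<Rightarrow> 'a set set \<Rightarrow> bool" where
  "uniform k E \<longleftrightarrow> (\<forall>e\<in>E. finite e \<and> card e = k)"

text \<open>
  A multihypergraph is a (finite) multiset of edges.  In the union of \<open>H 1, \<dots>, H m\<close> the
  multiplicity of an edge \<open>e\<close> is the number of \<open>j\<close> with \<open>e \<in> H j\<close>.  As \<open>mset_set\<close> maps
  infinite sets to the empty multiset, this is meaningful only for finite \<open>H j\<close>.
\<close>

definition multi_union :: "nat \<Rightarrow> (nat \<Rightarrow> 'a set set) \<Rightarrow> 'a set multiset" where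
  "multi_union m H = (\<Sum>j\<in>{1..m}. mset_set (H j))"

definition deg :: "'a set multiset \<Rightarrow> 'a \<Rightarrow> nat" where
  "deg M v = size {# e \<in># M. v \<in> e #}"

text \<open>
  The set of degrees is finite even for infinite \<open>V\<close>, since every degree is at most \<open>size M\<close>;
  so \<open>Max\<close> is the genuine maximum whenever \<open>V\<close> is nonempty.
\<close>

definition max_degree :: "'a set \<Rightarrow> 'a set multiset \<Rightarrow> nat" where
  "max_degree V M = Max (deg M ` V)"

definition is_SJR :: "nat \<Rightarrow> (nat \<Rightarrow> 'a set set) \<Rightarrow> (nat \<Rightarrow> 'a set) \<Rightarrow> bool" where
  "is_SJR m H f \<longleftrightarrow>
     f \<in> {1..m} \<rightarrow> (\<Union>i\<in>{1..m}. H i) \<and>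
     (\<forall>i\<in>{1..m}. f i \<in> H i) \<and>
     (\<forall>i\<in>{1..m}. \<forall>j\<in>{1..m}. i \<noteq> j \<longrightarrow> f i \<inter> f j = {})"

end

theory Submission
  imports Defs Complex_Main "HOL-Library.Product_Lexorder"
begin

text \<open>
  Take the pairs \<open>(i, e)\<close> with \<open>e \<in> H i\<close> as vertices, coloured by \<open>i\<close>, and consider the simplicial
  complex of sets of pairwise disjoint edges; an SJR is a rainbow face.  Let \<open>n\<close> be the number of
  vertices with colours in \<open>I\<close>.  On these vertices the Laplacian in degree \<open>r\<close> (faces with \<open>r\<close>
  elements) is bounded below by \<open>n - r k \<Delta>\<close>, because the Gram matrix \<open>|E x \<inter> E y|\<close> of the edges is
  positive semidefinite and has row sums at most \<open>k \<Delta>\<close>.  As \<open>n \<ge> |I| k \<Delta>\<close>, the real homology in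
  degree \<open>r = |I| - 1\<close> vanishes.  Hence one can build recursively chains \<open>c I\<close>, supported on faces of
  size \<open>|I|\<close> with colours in \<open>I\<close>, satisfying \<open>\<partial> (c I) = \<Sum>i\<in>I. \<plusminus> c (I - {i})\<close> and \<open>c {} = 1\<close>.
  The total weight of \<open>c I\<close> on rainbow sets is \<open>1\<close> by induction, so rainbow faces exist.
\<close>

subsection \<open>Chains with real coefficients\<close>

text \<open>The sign \<open>(- 1) ^ p\<close>, with \<open>p\<close> the position at which
  \<open>x\<close> enters the increasing listing of \<open>S\<close>: the incidence sign of
  \<open>S\<close> in \<open>insert x S\<close>.\<close>

definition osign :: "'v::linorder \<Rightarrow> 'v set \<Rightarrow> real" where
  "osign x S = (- 1) ^ card {y \<in> S. y < x}"

text \<open>A chain is encoded by its coefficient function, so the coefficient of the boundary at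
  \<open>S\<close> collects the cofaces \<open>insert x S\<close>. The case \<open>S = {}\<close> is
  included, hence this is the boundary of the augmented complex and the homology is reduced.\<close>

definition boundary :: "'v::linorder set \<Rightarrow> ('v set \<Rightarrow> real) \<Rightarrow> 'v set \<Rightarrow> real" where
  "boundary W f S = (\<Sum>x\<in>W - S. osign x S * f (insert x S))"

text \<open>The independence complex of the intersection graph of the edges
  \<open>E x\<close>.\<close>

definition indep :: "'v set \<Rightarrow> ('v \<Rightarrow> 'a set) \<Rightarrow> 'v set set" where
  "indep W E = {S. S \<subseteq> W \<and> pairwise (\<lambda>x y. disjnt (E x) (E y)) S}"

lemma osign_mult_self [simp]: "osign x S * osign x S = 1"
  by (simp add: osign_def flip: power_mult_distrib)

lemma osign_insert:
  assumes "finite S" "y \<notin> S"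
  shows "osign x (insert y S) = (if y < x then - osign x S else osign x S)"
proof -
  have "{z \<in> insert y S. z < x} = (if y < x then insert y {z \<in> S. z < x} else {z \<in> S. z < x})"
    by auto
  then show ?thesis
    using assms by (simp add: osign_def)
qed

text \<open>Exactly one of \<open>y < x\<close> and \<open>x < y\<close> holds, so exactly one of
  the two signs flips. This form relates mixed coboundary terms to mixed boundary terms.\<close>

lemma osign_exchange:
  assumes "finite S" "x \<notin> S" "y \<notin> S" "x \<noteq> y"
  shows "osign x (insert y S) * osign y (insert x S) = - (osign x S * osign y S)"
  using assms by (auto simp: osign_insert)

text \<open>The same single flip, in the form that makes the square of the boundary vanish.\<close>

lemma osign_anticommute:
  assumes "finite S" "x \<notin> S" "y \<notin> S" "x \<noteq> y"
  shows "osign x (insert y S) * osign y S = - (osign y (insert x S) * osign x S)"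
  using assms by (auto simp: osign_insert)

section \<open>Reindexing sums over faces and cofaces\<close>

text \<open>The map \<open>(S, x)\<close> to \<open>(insert x S, x)\<close> is a bijection of
  incident pairs. It moves a sum between sets and their one-element extensions.\<close>

lemma sum_insert_pairs:
  fixes g :: "'v \<Rightarrow> 'v set \<Rightarrow> real"
  assumes "finite W"
  shows "(\<Sum>S\<in>Pow W. \<Sum>x\<in>W - S. g x S) = (\<Sum>T\<in>Pow W. \<Sum>x\<in>T. g x (T - {x}))"
proof -
  have fin: "finite T" if "T \<in> Pow W" for T
    using that assms finite_subset by auto
  have "(\<Sum>S\<in>Pow W. \<Sum>x\<in>W - S. g x S) = (\<Sum>(S, x)\<in>(SIGMA S:Pow W. W - S). g x S)"
    using assms by (intro sum.Sigma) auto
  also have "\<dots> = (\<Sum>(T, x)\<in>(SIGMA T:Pow W. T). g x (T - {x}))"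
    by (rule sum.reindex_bij_witness[where i = "\<lambda>(T, x). (T - {x}, x)" and j = "\<lambda>(S, x). (insert x S, x)"])
      auto
  also have "\<dots> = (\<Sum>T\<in>Pow W. \<Sum>x\<in>T. g x (T - {x}))"
    using assms fin by (intro sum.Sigma[symmetric]) auto
  finally show ?thesis .
qed

lemma sum_off_diagonal_swap:
  fixes h :: "'v \<Rightarrow> 'v \<Rightarrow> real"
  assumes "finite P"
  shows "(\<Sum>x\<in>P. \<Sum>y\<in>P - {x}. h x y) = (\<Sum>x\<in>P. \<Sum>y\<in>P - {x}. h y x)"
proof -
  have "(\<Sum>x\<in>P. \<Sum>y\<in>P - {x}. h x y) = (\<Sum>(x, y)\<in>(SIGMA x:P. P - {x}). h x y)"
    using assms by (intro sum.Sigma) auto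
  also have "\<dots> = (\<Sum>(x, y)\<in>(SIGMA x:P. P - {x}). h y x)"
    by (rule sum.reindex_bij_witness[where i = "\<lambda>(x, y). (y, x)" and j = "\<lambda>(x, y). (y, x)"]) auto
  also have "\<dots> = (\<Sum>x\<in>P. \<Sum>y\<in>P - {x}. h y x)"
    using assms by (intro sum.Sigma[symmetric]) auto
  finally show ?thesis .
qed

lemma sum_antisymmetric:
  fixes h :: "'v \<Rightarrow> 'v \<Rightarrow> real"
  assumes "finite P" "\<And>x y. x \<in> P \<Longrightarrow> y \<in> P \<Longrightarrow> x \<noteq> y \<Longrightarrow> h x y = - h y x"
  shows "(\<Sum>x\<in>P. \<Sum>y\<in>P - {x}. h x y) = 0"
proof -
  have "(\<Sum>x\<in>P. \<Sum>y\<in>P - {x}. h x y) = (\<Sum>x\<in>P. \<Sum>y\<in>P - {x}. - h y x)"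
    using assms(2) by (intro sum.cong refl) auto
  also have "\<dots> = - (\<Sum>x\<in>P. \<Sum>y\<in>P - {x}. h x y)"
    by (simp add: sum_negf sum_off_diagonal_swap[OF assms(1), of h])
  finally show ?thesis by simp
qed

lemma sum_insert_triples:
  fixes g :: "'v \<Rightarrow> 'v \<Rightarrow> 'v set \<Rightarrow> real"
  assumes "finite W"
  shows "(\<Sum>S\<in>Pow W. \<Sum>x\<in>W - S. \<Sum>y\<in>W - S - {x}. g x y S) =
    (\<Sum>T\<in>Pow W. \<Sum>x\<in>T. \<Sum>y\<in>T - {x}. g x y (T - {x, y}))"
proof -
  have "(\<Sum>S\<in>Pow W. \<Sum>x\<in>W - S. \<Sum>y\<in>W - S - {x}. g x y S) =
      (\<Sum>T\<in>Pow W. \<Sum>x\<in>T. \<Sum>y\<in>W - (T - {x}) - {x}. g x y (T - {x}))"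
    by (rule sum_insert_pairs[OF assms])
  also have "\<dots> = (\<Sum>T\<in>Pow W. \<Sum>x\<in>T. \<Sum>y\<in>W - T. g x y (T - {x}))"
    by (intro sum.cong refl) auto
  also have "\<dots> = (\<Sum>T\<in>Pow W. \<Sum>y\<in>W - T. \<Sum>x\<in>T. g x y (T - {x}))"
    by (intro sum.cong refl sum.swap)
  also have "\<dots> = (\<Sum>T\<in>Pow W. \<Sum>y\<in>T. \<Sum>x\<in>T - {y}. g x y (T - {y} - {x}))"
    by (rule sum_insert_pairs[OF assms])
  also have "\<dots> = (\<Sum>T\<in>Pow W. \<Sum>y\<in>T. \<Sum>x\<in>T - {y}. g x y (T - {x, y}))"
    by (intro sum.cong refl arg_cong[where f = "g _ _"]) auto
  also have "\<dots> = (\<Sum>T\<in>Pow W. \<Sum>x\<in>T. \<Sum>y\<in>T - {x}. g x y (T - {x, y}))"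
    using assms finite_subset
    by (intro sum.cong[OF refl] sum_off_diagonal_swap[THEN trans]) (auto simp: insert_commute)
  finally show ?thesis .
qed

lemma sum_square_off_diagonal:
  fixes p :: "'v \<Rightarrow> real"
  assumes "finite P"
  shows "(\<Sum>x\<in>P. p x)\<^sup>2 = (\<Sum>x\<in>P. (p x)\<^sup>2) + (\<Sum>x\<in>P. \<Sum>y\<in>P - {x}. p x * p y)"
proof -
  have "(\<Sum>x\<in>P. p x)\<^sup>2 = (\<Sum>x\<in>P. \<Sum>y\<in>P. p x * p y)"
    by (simp add: power2_eq_square sum_product)
  also have "\<dots> = (\<Sum>x\<in>P. (p x)\<^sup>2 + (\<Sum>y\<in>P - {x}. p x * p y))"
    using assms by (intro sum.cong refl) (simp add: sum.remove power2_eq_square)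
  finally show ?thesis by (simp add: sum.distrib)
qed

subsection \<open>Vanishing of homology\<close>

text \<open>Orthogonal projection of \<open>z\<close> to the span of the \<open>b j\<close>, by
  Gram-Schmidt: take the residuals of \<open>z\<close> and of the new vector against the old ones,
  then remove from the former its component along the latter.\<close>

lemma ex_orthogonal_residual:
  fixes b :: "'k \<Rightarrow> 'i \<Rightarrow> real"
  assumes "finite K" "finite S"
  shows "\<exists>a. \<forall>k\<in>K. (\<Sum>s\<in>S. (z s - (\<Sum>j\<in>K. a j * b j s)) * b k s) = 0"
  using assms(1)
proof (induction K arbitrary: z rule: finite_induct)
  case empty
  then show ?case by simp
next
  case (insert l K)
  obtain a where a: "\<And>k. k \<in> K \<Longrightarrow> (\<Sum>s\<in>S. (b l s - (\<Sum>j\<in>K. a j * b j s)) * b k s) = 0"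
    using insert.IH[of "b l"] by blast
  obtain c where c: "\<And>k. k \<in> K \<Longrightarrow> (\<Sum>s\<in>S. (z s - (\<Sum>j\<in>K. c j * b j s)) * b k s) = 0"
    using insert.IH[of z] by blast
  define p where "p s = b l s - (\<Sum>j\<in>K. a j * b j s)" for s
  define q where "q s = z s - (\<Sum>j\<in>K. c j * b j s)" for s
  \<comment> \<open>If \<open>p\<close> vanishes on \<open>S\<close>, the division by zero gives
    \<open>t = 0\<close>; any value would do, since both sides of the identity for \<open>t\<close>
    below are then zero.\<close>
  define t where "t = (\<Sum>s\<in>S. q s * p s) / (\<Sum>s\<in>S. p s * p s)"
  have orth: "(\<Sum>s\<in>S. (q s - t * p s) * b k s) = 0" if "k \<in> K" for k
  proof -
    have "(\<Sum>s\<in>S. (q s - t * p s) * b k s) = (\<Sum>s\<in>S. q s * b k s) - t * (\<Sum>s\<in>S. p s * b k s)"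
      by (simp add: left_diff_distrib sum_subtractf sum_distrib_left mult.assoc)
    then show ?thesis using a[OF that] c[OF that] by (simp add: p_def q_def)
  qed
  have "(\<Sum>s\<in>S. q s * p s) = t * (\<Sum>s\<in>S. p s * p s)"
  proof (cases "(\<Sum>s\<in>S. p s * p s) = 0")
    case True
    then have "\<forall>s\<in>S. p s = 0"
      using assms(2) by (simp add: sum_nonneg_eq_0_iff)
    then show ?thesis by simp
  qed (simp add: t_def)
  then have orth_p: "(\<Sum>s\<in>S. (q s - t * p s) * p s) = 0"
    by (simp add: left_diff_distrib sum_subtractf sum_distrib_left mult.assoc)
  have expand: "r * b l s = r * p s + (\<Sum>j\<in>K. a j * (r * b j s))" for r s
    by (simp add: p_def right_diff_distrib sum_distrib_left mult.left_commute)
  have "(\<Sum>s\<in>S. (q s - t * p s) * b l s) =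
      (\<Sum>s\<in>S. (q s - t * p s) * p s + (\<Sum>j\<in>K. a j * ((q s - t * p s) * b j s)))"
    by (intro sum.cong refl expand)
  also have "\<dots> = (\<Sum>j\<in>K. \<Sum>s\<in>S. a j * ((q s - t * p s) * b j s))"
    by (simp add: sum.distrib orth_p sum.swap[of _ K])
  also have "\<dots> = 0"
    using orth by (simp flip: sum_distrib_left)
  finally have orth_l: "(\<Sum>s\<in>S. (q s - t * p s) * b l s) = 0" .
  \<comment> \<open>The coefficients come from collecting terms in \<open>q - t * p\<close>, where
    \<open>p\<close> contains \<open>b l\<close> with coefficient 1 and each \<open>b j\<close> with
    coefficient \<open>- a j\<close>.\<close>
  define d where "d j = (if j = l then t else c j - t * a j)" for j
  have "z s - (\<Sum>j\<in>insert l K. d j * b j s) = q s - t * p s" for s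
  proof -
    have "(\<Sum>j\<in>K. d j * b j s) = (\<Sum>j\<in>K. c j * b j s - t * (a j * b j s))"
      using insert.hyps by (intro sum.cong) (auto simp: d_def algebra_simps)
    then show ?thesis
      using insert.hyps
      by (simp add: p_def q_def d_def sum_subtractf right_diff_distrib flip: sum_distrib_left)
  qed
  then show ?case
    using orth orth_l by (intro exI[of _ d]) simp
qed

text \<open>
  Replacing adjacency by \<open>|E x \<inter> E y|\<close> gives a Gram matrix; the excess over adjacency is
  \<open>|E x \<inter> E y| - 1\<close>, truncated at \<open>0\<close> (by natural number subtraction) for disjoint edges.
\<close>

lemma intersection_form_lower_bound:
  fixes p :: "'v \<Rightarrow> real" and E :: "'v \<Rightarrow> 'a set"
  assumes W: "finite W" and P: "P \<subseteq> W" and E: "\<And>x. x \<in> W \<Longrightarrow> finite (E x)"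
  shows "(\<Sum>x\<in>P. \<Sum>y\<in>P - {x}. of_bool (\<not> disjnt (E x) (E y)) * (p x * p y)) \<ge>
    - (\<Sum>x\<in>P. (card (E x) + (\<Sum>y\<in>W - {x}. real (card (E x \<inter> E y) - 1))) * (p x)\<^sup>2)"
proof -
  have fP: "finite P" using P W finite_subset by blast
  define U where "U = (\<Union>x\<in>P. E x)"
  have fU: "finite U" unfolding U_def using fP P E by blast
  define c where "c x y = real (card (E x \<inter> E y) - 1)" for x y
  have split: "real (card (E x \<inter> E y)) = of_bool (\<not> disjnt (E x) (E y)) + c x y" if "x \<in> P" for x y
  proof (cases "disjnt (E x) (E y)")
    case True
    then show ?thesis by (simp add: c_def disjnt_def)
  next
    case False
    then have "card (E x \<inter> E y) > 0"
      using that P E by (auto simp: disjnt_def card_gt_0_iff)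
    then show ?thesis using False by (simp add: c_def of_nat_diff)
  qed
  \<comment> \<open>The Gram form as a sum of squares over the points \<open>w\<close>: a pair
    \<open>x\<close>, \<open>y\<close> is counted once for every common point of its two
    edges.\<close>
  have "0 \<le> (\<Sum>w\<in>U. (\<Sum>x\<in>P. of_bool (w \<in> E x) * p x)\<^sup>2)"
    by (simp add: sum_nonneg)
  also have "\<dots> = (\<Sum>w\<in>U. \<Sum>x\<in>P. \<Sum>y\<in>P. of_bool (w \<in> E x \<inter> E y) * (p x * p y))"
    unfolding power2_eq_square sum_product by (intro sum.cong refl) auto
  also have "\<dots> = (\<Sum>x\<in>P. \<Sum>w\<in>U. \<Sum>y\<in>P. of_bool (w \<in> E x \<inter> E y) * (p x * p y))"
    by (rule sum.swap)
  also have "\<dots> = (\<Sum>x\<in>P. \<Sum>y\<in>P. \<Sum>w\<in>U. of_bool (w \<in> E x \<inter> E y) * (p x * p y))"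
    by (intro sum.cong refl sum.swap)
  also have "\<dots> = (\<Sum>x\<in>P. \<Sum>y\<in>P. card (E x \<inter> E y) * (p x * p y))"
  proof (intro sum.cong refl)
    fix x y assume "x \<in> P" "y \<in> P"
    then have "U \<inter> {w \<in> E x. w \<in> E y} = E x \<inter> E y" by (auto simp: U_def)
    then show "(\<Sum>w\<in>U. of_bool (w \<in> E x \<inter> E y) * (p x * p y)) = card (E x \<inter> E y) * (p x * p y)"
      using fU by (simp flip: sum_distrib_right)
  qed
  also have "\<dots> = (\<Sum>x\<in>P. card (E x) * (p x)\<^sup>2 + (\<Sum>y\<in>P - {x}. card (E x \<inter> E y) * (p x * p y)))"
    using fP by (intro sum.cong refl) (simp add: sum.remove power2_eq_square)
  also have "\<dots> = (\<Sum>x\<in>P. card (E x) * (p x)\<^sup>2) +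
      (\<Sum>x\<in>P. \<Sum>y\<in>P - {x}. of_bool (\<not> disjnt (E x) (E y)) * (p x * p y)) +
      (\<Sum>x\<in>P. \<Sum>y\<in>P - {x}. c x y * (p x * p y))"
    by (simp add: split sum.distrib distrib_right)
  finally have 1: "0 \<le> (\<Sum>x\<in>P. card (E x) * (p x)\<^sup>2) +
      (\<Sum>x\<in>P. \<Sum>y\<in>P - {x}. of_bool (\<not> disjnt (E x) (E y)) * (p x * p y)) +
      (\<Sum>x\<in>P. \<Sum>y\<in>P - {x}. c x y * (p x * p y))" .
  have sym: "(\<Sum>x\<in>P. \<Sum>y\<in>P - {x}. c x y * (p y)\<^sup>2) = (\<Sum>x\<in>P. \<Sum>y\<in>P - {x}. c x y * (p x)\<^sup>2)"
    using sum_off_diagonal_swap[OF fP, of "\<lambda>x y. c x y * (p y)\<^sup>2"] by (simp add: c_def Int_commute)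
  \<comment> \<open>The arithmetic-geometric mean inequality and the symmetry of \<open>c\<close>
    push the excess form to the diagonal.\<close>
  have "(\<Sum>x\<in>P. \<Sum>y\<in>P - {x}. c x y * (p x * p y)) \<le>
      (\<Sum>x\<in>P. \<Sum>y\<in>P - {x}. (c x y * (p x)\<^sup>2 + c x y * (p y)\<^sup>2) / 2)"
  proof (intro sum_mono)
    fix x y
    have "p x * p y \<le> ((p x)\<^sup>2 + (p y)\<^sup>2) / 2"
      using sum_squares_bound[of "p x" "p y"] by (simp add: algebra_simps)
    then have "c x y * (p x * p y) \<le> c x y * (((p x)\<^sup>2 + (p y)\<^sup>2) / 2)"
      by (rule mult_left_mono) (simp add: c_def)
    then show "c x y * (p x * p y) \<le> (c x y * (p x)\<^sup>2 + c x y * (p y)\<^sup>2) / 2"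
      by (simp add: algebra_simps)
  qed
  also have "\<dots> = (\<Sum>x\<in>P. \<Sum>y\<in>P - {x}. c x y * (p x)\<^sup>2)"
    by (simp add: sum.distrib sym flip: sum_divide_distrib)
  \<comment> \<open>Row sums over all of \<open>W\<close> no longer depend on \<open>P\<close>,
    which is \<open>W - S\<close> with varying \<open>S\<close> in the application.\<close>
  also have "\<dots> \<le> (\<Sum>x\<in>P. \<Sum>y\<in>W - {x}. c x y * (p x)\<^sup>2)"
    using W P by (intro sum_mono sum_mono2) (auto simp: c_def)
  finally have 2: "(\<Sum>x\<in>P. \<Sum>y\<in>P - {x}. c x y * (p x * p y)) \<le> (\<Sum>x\<in>P. (\<Sum>y\<in>W - {x}. c x y) * (p x)\<^sup>2)"
    by (simp add: sum_distrib_right)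
  show ?thesis
    using 1 2 by (simp add: c_def distrib_right sum.distrib)
qed


text \<open>
  Adding the vanishing squared norms of the boundary and of the coboundary of \<open>\<phi>\<close>, the mixed terms
  \<open>p S x * p S y\<close> with \<open>E x\<close> and \<open>E y\<close> disjoint cancel; the remaining ones are controlled by the
  intersection form.  The excess \<open>s x\<close> lost there is regained exactly in the count \<open>d x\<close> of
  neighbours, since \<open>k + s x + d x = (\<Sum>y\<in>W. |E x \<inter> E y|)\<close>.
\<close>

lemma harmonic_eq_0:
  fixes E :: "'v::linorder \<Rightarrow> 'a set"
  assumes W: "finite W"
    and E: "\<And>x. x \<in> W \<Longrightarrow> finite (E x) \<and> card (E x) = k"
    and deg: "\<And>w. card {x \<in> W. w \<in> E x} \<le> D"
    and large: "card W > r * k * D"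
    and supp: "\<And>S. \<phi> S \<noteq> 0 \<Longrightarrow> S \<in> indep W E \<and> card S = r"
    and cycle: "\<And>S. S \<subseteq> W \<Longrightarrow> boundary W \<phi> S = 0"
    and cocycle: "\<And>T. T \<in> indep W E \<Longrightarrow> (\<Sum>x\<in>T. osign x (T - {x}) * \<phi> (T - {x})) = 0"
  shows "\<phi> S = 0"
proof -
  define p where "p S x = osign x S * \<phi> (insert x S)" for S x
  define s where "s x = (\<Sum>y\<in>W - {x}. real (card (E x \<inter> E y) - 1))" for x
  define d where "d x = (\<Sum>y\<in>W - {x}. of_bool (\<not> disjnt (E x) (E y)) :: real)" for x
  define N where "N S = card {x \<in> W - S. insert x S \<in> indep W E}" for S
  have fin: "finite T" if "T \<in> Pow W" for T
    using that W finite_subset by auto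
  have p_sq: "(p S x)\<^sup>2 = (\<phi> (insert x S))\<^sup>2" for S x
    by (simp add: p_def power_mult_distrib power2_eq_square[of "osign x S"])

  have down: "0 = (\<Sum>S\<in>Pow W. (\<Sum>x\<in>W - S. (p S x)\<^sup>2)) + (\<Sum>S\<in>Pow W. \<Sum>x\<in>W - S. \<Sum>y\<in>W - S - {x}. p S x * p S y)"
  proof -
    have "(\<Sum>S\<in>Pow W. (\<Sum>x\<in>W - S. p S x)\<^sup>2) = 0"
      using cycle by (simp add: boundary_def p_def)
    then show ?thesis
      using W by (simp add: sum_square_off_diagonal sum.distrib)
  qed

  \<comment> \<open>If both values of \<open>\<phi>\<close> are nonzero, then
    \<open>insert x S\<close> and \<open>insert y S\<close> are faces, so disjointness of
    \<open>E x\<close> and \<open>E y\<close> alone decides whether their union is a face. The minus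
    sign is the single sign flip.\<close>
  have off: "of_bool (insert x (insert y S) \<in> indep W E) *
      (osign x (insert y S) * osign y (insert x S) * (\<phi> (insert y S) * \<phi> (insert x S))) =
      - (of_bool (disjnt (E x) (E y)) * (p S x * p S y))"
    if "S \<in> Pow W" "x \<in> W - S" "y \<in> W - S - {x}" for S x y
  proof (cases "\<phi> (insert y S) * \<phi> (insert x S) = 0")
    case True
    then show ?thesis by (auto simp: p_def)
  next
    case False
    then have "insert y S \<in> indep W E" "insert x S \<in> indep W E"
      using supp by auto
    then have "insert x (insert y S) \<in> indep W E \<longleftrightarrow> disjnt (E x) (E y)"
      using that by (auto simp: indep_def pairwise_insert disjnt_sym)
    moreover have "osign x (insert y S) * osign y (insert x S) = - (osign x S * osign y S)"
      using that by (intro osign_exchange fin) auto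
    ultimately show ?thesis by (simp add: p_def)
  qed

  have up: "0 = (\<Sum>S\<in>Pow W. N S * (\<phi> S)\<^sup>2) -
    (\<Sum>S\<in>Pow W. \<Sum>x\<in>W - S. \<Sum>y\<in>W - S - {x}. of_bool (disjnt (E x) (E y)) * (p S x * p S y))"
  proof -
    let ?c = "\<lambda>T x. osign x (T - {x}) * \<phi> (T - {x})"
    let ?i = "\<lambda>T. of_bool (T \<in> indep W E) :: real"
    \<comment> \<open>The indicator is essential: the coboundary is known to vanish only at faces
      \<open>T\<close>. The diagonal terms of the expansion will count the cofaces of
      \<open>S\<close>, which gives \<open>N S\<close>.\<close>
    have "0 = (\<Sum>T\<in>Pow W. ?i T * (\<Sum>x\<in>T. ?c T x)\<^sup>2)"
      by (intro sum.neutral[symmetric]) (simp add: cocycle of_bool_def)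
    also have "\<dots> = (\<Sum>T\<in>Pow W. \<Sum>x\<in>T. ?i T * (\<phi> (T - {x}))\<^sup>2) +
        (\<Sum>T\<in>Pow W. \<Sum>x\<in>T. \<Sum>y\<in>T - {x}. ?i T * (?c T x * ?c T y))"
      unfolding sum.distrib[symmetric]
      using fin by (intro sum.cong refl)
        (simp add: sum_square_off_diagonal distrib_left sum_distrib_left power_mult_distrib
          power2_eq_square[of "osign _ _"] sum.distrib)
    also have "(\<Sum>T\<in>Pow W. \<Sum>x\<in>T. ?i T * (\<phi> (T - {x}))\<^sup>2) =
        (\<Sum>T\<in>Pow W. \<Sum>x\<in>T. ?i (insert x (T - {x})) * (\<phi> (T - {x}))\<^sup>2)"
      by (intro sum.cong refl) (simp add: insert_absorb)
    also have "\<dots> = (\<Sum>S\<in>Pow W. \<Sum>x\<in>W - S. ?i (insert x S) * (\<phi> S)\<^sup>2)"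
      by (rule sum_insert_pairs[OF W, symmetric])
    also have "\<dots> = (\<Sum>S\<in>Pow W. N S * (\<phi> S)\<^sup>2)"
      using W by (simp add: N_def Int_def conj_ac flip: sum_distrib_right)
    also have "(\<Sum>T\<in>Pow W. \<Sum>x\<in>T. \<Sum>y\<in>T - {x}. ?i T * (?c T x * ?c T y)) =
        (\<Sum>T\<in>Pow W. \<Sum>x\<in>T. \<Sum>y\<in>T - {x}. of_bool (insert x (insert y (T - {x, y})) \<in> indep W E) *
          (osign x (insert y (T - {x, y})) * osign y (insert x (T - {x, y})) *
            (\<phi> (insert y (T - {x, y})) * \<phi> (insert x (T - {x, y})))))"
    proof (intro sum.cong refl)
      fix T :: "'v set" and x y assume "x \<in> T" "y \<in> T - {x}"
      then have "insert x (insert y (T - {x, y})) = T" "insert y (T - {x, y}) = T - {x}"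
        "insert x (T - {x, y}) = T - {y}"
        by auto
      then show "?i T * (?c T x * ?c T y) = of_bool (insert x (insert y (T - {x, y})) \<in> indep W E) *
          (osign x (insert y (T - {x, y})) * osign y (insert x (T - {x, y})) *
            (\<phi> (insert y (T - {x, y})) * \<phi> (insert x (T - {x, y}))))"
        by simp
    qed
    also have "\<dots> = (\<Sum>S\<in>Pow W. \<Sum>x\<in>W - S. \<Sum>y\<in>W - S - {x}. of_bool (insert x (insert y S) \<in> indep W E) *
          (osign x (insert y S) * osign y (insert x S) * (\<phi> (insert y S) * \<phi> (insert x S))))"
      by (rule sum_insert_triples[OF W, symmetric])
    also have "\<dots> = (\<Sum>S\<in>Pow W. \<Sum>x\<in>W - S. \<Sum>y\<in>W - S - {x}. - (of_bool (disjnt (E x) (E y)) * (p S x * p S y)))"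
      by (intro sum.cong refl off)
    finally show ?thesis by (simp add: sum_negf)
  qed

  have "- (\<Sum>x\<in>W - S. (k + s x) * (p S x)\<^sup>2) \<le>
      (\<Sum>x\<in>W - S. \<Sum>y\<in>W - S - {x}. of_bool (\<not> disjnt (E x) (E y)) * (p S x * p S y))" for S
    using intersection_form_lower_bound[OF W, of "W - S" E "p S"] E by (simp add: s_def)
  then have "- (\<Sum>S\<in>Pow W. \<Sum>x\<in>W - S. (k + s x) * (p S x)\<^sup>2) \<le>
      (\<Sum>S\<in>Pow W. \<Sum>x\<in>W - S. \<Sum>y\<in>W - S - {x}. of_bool (\<not> disjnt (E x) (E y)) * (p S x * p S y))"
    unfolding sum_negf[where A = "Pow W", symmetric] by (rule sum_mono)
  moreover have "(\<Sum>S\<in>Pow W. \<Sum>x\<in>W - S. \<Sum>y\<in>W - S - {x}. p S x * p S y) =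
      (\<Sum>S\<in>Pow W. \<Sum>x\<in>W - S. \<Sum>y\<in>W - S - {x}. of_bool (\<not> disjnt (E x) (E y)) * (p S x * p S y)) +
      (\<Sum>S\<in>Pow W. \<Sum>x\<in>W - S. \<Sum>y\<in>W - S - {x}. of_bool (disjnt (E x) (E y)) * (p S x * p S y))"
    unfolding sum.distrib[symmetric] by (intro sum.cong refl) (auto simp: of_bool_def)
  ultimately have "(\<Sum>S\<in>Pow W. N S * (\<phi> S)\<^sup>2) + (\<Sum>S\<in>Pow W. \<Sum>x\<in>W - S. (p S x)\<^sup>2) -
      (\<Sum>S\<in>Pow W. \<Sum>x\<in>W - S. (k + s x) * (p S x)\<^sup>2) \<le> 0"
    using up down by linarith
  \<comment> \<open>Squares at \<open>(S, x)\<close> are squares of \<open>\<phi>\<close> at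
    \<open>insert x S\<close>; collected there, the whole form becomes diagonal, each face
    \<open>T\<close> receiving one term \<open>1 - k - s x\<close> per element.\<close>
  moreover have "(\<Sum>S\<in>Pow W. \<Sum>x\<in>W - S. (p S x)\<^sup>2) - (\<Sum>S\<in>Pow W. \<Sum>x\<in>W - S. (k + s x) * (p S x)\<^sup>2) =
      (\<Sum>S\<in>Pow W. \<Sum>x\<in>W - S. (1 - real k - s x) * (\<phi> (insert x S))\<^sup>2)"
    by (simp add: p_sq algebra_simps sum.distrib sum_subtractf)
  moreover have "\<dots> = (\<Sum>T\<in>Pow W. \<Sum>x\<in>T. (1 - real k - s x) * (\<phi> (insert x (T - {x})))\<^sup>2)"
    by (rule sum_insert_pairs[OF W])
  moreover have "\<dots> = (\<Sum>T\<in>Pow W. (\<Sum>x\<in>T. 1 - real k - s x) * (\<phi> T)\<^sup>2)"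
    unfolding sum_distrib_right by (intro sum.cong refl) (simp add: insert_absorb)
  ultimately have "(\<Sum>S\<in>Pow W. (N S + (\<Sum>x\<in>S. 1 - real k - s x)) * (\<phi> S)\<^sup>2) \<le> 0"
    by (simp add: distrib_right sum.distrib)
  \<comment> \<open>A vertex that does not extend \<open>S\<close> lies in \<open>S\<close> or is a
    neighbour of some \<open>u\<close> in \<open>S\<close>, so \<open>N S\<close> is at least
    \<open>card W\<close> minus the sum of \<open>1 + d u\<close>. The coefficient is thus at least
    \<open>card W\<close> minus the sum of \<open>k + s u + d u\<close>, and each of these
    \<open>r\<close> summands is at most \<open>k * D\<close>.\<close>
  moreover have coeff: "N S + (\<Sum>x\<in>S. 1 - real k - s x) > 0" if S: "S \<in> indep W E" "card S = r" for S
  proof -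
    have SW: "S \<subseteq> W" and fS: "finite S"
      using S W finite_subset by (auto simp: indep_def)
    have kds: "k + s x + d x \<le> k * D" if x: "x \<in> W" for x
    proof -
      have "real k + s x + d x = real k + (\<Sum>y\<in>W - {x}. real (card (E x \<inter> E y)))"
      proof -
        have "real (card (E x \<inter> E y) - 1) + of_bool (\<not> disjnt (E x) (E y)) = real (card (E x \<inter> E y))" for y
          using E[OF x] by (cases "E x \<inter> E y = {}") (auto simp: disjnt_def of_nat_diff Suc_leI card_gt_0_iff)
        then show ?thesis by (simp add: s_def d_def flip: sum.distrib)
      qed
      \<comment> \<open>The term \<open>k\<close> is the missing summand \<open>y = x\<close>;
        afterwards the incidences are counted by the points of \<open>E x\<close>.\<close>
      also have "\<dots> = (\<Sum>y\<in>W. real (card (E x \<inter> E y)))"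
        using W x E by (simp add: sum.remove)
      also have "\<dots> = (\<Sum>y\<in>W. \<Sum>w\<in>E x. of_bool (w \<in> E y))"
        using E[OF x] by (simp add: Int_def)
      also have "\<dots> = (\<Sum>w\<in>E x. \<Sum>y\<in>W. of_bool (w \<in> E y))"
        by (rule sum.swap)
      also have "\<dots> = (\<Sum>w\<in>E x. real (card {y \<in> W. w \<in> E y}))"
        using W by (simp add: Int_def)
      also have "\<dots> \<le> (\<Sum>w\<in>E x. real D)"
        using deg by (intro sum_mono) simp
      finally show ?thesis using E[OF x] by simp
    qed
    have "W \<subseteq> {x \<in> W - S. insert x S \<in> indep W E} \<union>
        (\<Union>u\<in>S. insert u {y \<in> W - {u}. \<not> disjnt (E u) (E y)})"
      using S by (auto simp: indep_def pairwise_insert disjnt_sym)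
    then have "card W \<le> card ({x \<in> W - S. insert x S \<in> indep W E} \<union>
        (\<Union>u\<in>S. insert u {y \<in> W - {u}. \<not> disjnt (E u) (E y)}))"
      using W fS by (intro card_mono) auto
    also have "\<dots> \<le> N S + card (\<Union>u\<in>S. insert u {y \<in> W - {u}. \<not> disjnt (E u) (E y)})"
      unfolding N_def by (rule card_Un_le)
    also have "\<dots> \<le> N S + (\<Sum>u\<in>S. card (insert u {y \<in> W - {u}. \<not> disjnt (E u) (E y)}))"
      using fS by (intro add_left_mono card_UN_le)
    finally have "real (card W) \<le> N S + (\<Sum>u\<in>S. real (card (insert u {y \<in> W - {u}. \<not> disjnt (E u) (E y)})))"
      by (simp flip: of_nat_sum of_nat_add)
    also have "(\<Sum>u\<in>S. real (card (insert u {y \<in> W - {u}. \<not> disjnt (E u) (E y)}))) = (\<Sum>u\<in>S. 1 + d u)"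
      using W by (intro sum.cong refl) (simp add: d_def Int_def)
    finally have "real (card W) \<le> N S + (\<Sum>u\<in>S. 1 + d u)" .
    moreover have "(\<Sum>u\<in>S. k + s u + d u) \<le> (\<Sum>u\<in>S. real (k * D))"
      using SW kds by (intro sum_mono) auto
    moreover have "(\<Sum>u\<in>S. real (k * D)) < card W"
      using large S by (simp add: mult.assoc flip: of_nat_mult)
    ultimately show ?thesis
      by (simp add: sum.distrib sum_subtractf right_diff_distrib)
  qed
  moreover have nonneg: "(N S + (\<Sum>x\<in>S. 1 - real k - s x)) * (\<phi> S)\<^sup>2 \<ge> 0" for S
    using supp[of S] coeff[of S] by (cases "\<phi> S = 0") auto
  ultimately have "\<forall>S\<in>Pow W. (N S + (\<Sum>x\<in>S. 1 - real k - s x)) * (\<phi> S)\<^sup>2 = 0"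
    using W by (metis (no_types, lifting) finite_Pow_iff order_antisym sum_nonneg sum_nonneg_eq_0_iff)
  then show "\<phi> S = 0"
    using supp[of S] coeff[of S] by (force simp: indep_def)
qed


section \<open>From harmonic chains to acyclicity\<close>

text \<open>Adding \<open>x\<close> and \<open>y\<close> in the two possible orders gives the same
  set with opposite signs.\<close>

lemma boundary_boundary:
  assumes "finite W" "S \<subseteq> W"
  shows "boundary W (boundary W f) S = 0"
proof -
  have fS: "finite S" using assms finite_subset by blast
  have "boundary W (boundary W f) S =
      (\<Sum>x\<in>W - S. \<Sum>y\<in>W - S - {x}. osign y (insert x S) * osign x S * f (insert x (insert y S)))"
    unfolding boundary_def sum_distrib_left
    by (intro sum.cong refl) (auto simp: insert_commute)
  also have "\<dots> = 0"
  proof (rule sum_antisymmetric)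
    fix x y assume "x \<in> W - S" "y \<in> W - S" "x \<noteq> y"
    then show "osign y (insert x S) * osign x S * f (insert x (insert y S)) =
        - (osign x (insert y S) * osign y S * f (insert y (insert x S)))"
      using osign_anticommute[OF fS, of x y] by (simp add: insert_commute)
  qed (use assms in simp)
  finally show ?thesis .
qed

lemma boundary_linear: "boundary W (\<lambda>S. \<Sum>i\<in>I. a i * f i S) S = (\<Sum>i\<in>I. a i * boundary W (f i) S)"
  unfolding boundary_def sum_distrib_left
  by (subst sum.swap) (simp add: mult_ac)

lemma boundary_diff: "boundary W (\<lambda>S. f S - g S) S = boundary W f S - boundary W g S"
  by (simp add: boundary_def right_diff_distrib sum_subtractf)

text \<open>Degree \<open>r\<close> counts elements, so it is one more than the dimension of the
  simplices.\<close>

definition chain :: "'v set set \<Rightarrow> nat \<Rightarrow> ('v set \<Rightarrow> real) \<Rightarrow> bool" where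
  "chain F r f \<longleftrightarrow> (\<forall>S. f S \<noteq> 0 \<longrightarrow> S \<in> F \<and> card S = r)"

text \<open>Finite-dimensional Hodge argument: subtract from the cycle \<open>z\<close> its
  orthogonal projection to the boundaries. The residual is a cycle, and orthogonality to all
  boundaries makes it a cocycle, so it is harmonic and hence zero.\<close>

lemma acyclic_indep:
  fixes E :: "'v::linorder \<Rightarrow> 'a set"
  assumes W: "finite W"
    and E: "\<And>x. x \<in> W \<Longrightarrow> finite (E x) \<and> card (E x) = k"
    and deg: "\<And>w. card {x \<in> W. w \<in> E x} \<le> D"
    and large: "card W > r * k * D"
    and z: "chain (indep W E) r z"
    and cycle: "\<And>S. S \<subseteq> W \<Longrightarrow> boundary W z S = 0"
  obtains f where "chain (indep W E) (Suc r) f" "\<And>S. boundary W f S = z S"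
proof -
  define K where "K = {T \<in> indep W E. card T = Suc r}"
  have fin: "finite T" if "T \<subseteq> W" for T
    using that W finite_subset by auto
  have fK: "finite K"
    using W by (auto simp: K_def indep_def intro: finite_subset[of _ "Pow W"])
  define b where "b T = boundary W (\<lambda>U. of_bool (U = T))" for T
  obtain a where a: "\<And>T. T \<in> K \<Longrightarrow> (\<Sum>S\<in>Pow W. (z S - (\<Sum>j\<in>K. a j * b j S)) * b T S) = 0"
    using ex_orthogonal_residual[OF fK, of "Pow W" z b] W by auto
  define f where "f S = (\<Sum>T\<in>K. a T * of_bool (S = T))" for S
  have f_eq: "f S = (if S \<in> K then a S else 0)" for S
    unfolding f_def using fK by (simp add: of_bool_def if_distrib cong: if_cong)
  have bd_f: "boundary W f S = (\<Sum>T\<in>K. a T * b T S)" for S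
    unfolding f_def b_def by (rule boundary_linear)
  have f: "chain (indep W E) (Suc r) f"
    by (auto simp: chain_def f_eq K_def)
  define \<phi> where "\<phi> S = z S - boundary W f S" for S
  have supp: "S \<in> indep W E \<and> card S = r" if "\<phi> S \<noteq> 0" for S
  proof (cases "z S = 0")
    case True
    then have "boundary W f S \<noteq> 0" using that by (simp add: \<phi>_def)
    then obtain x where "x \<in> W - S" "f (insert x S) \<noteq> 0"
      unfolding boundary_def by (metis (no_types, lifting) mult_zero_right sum.neutral)
    then have "insert x S \<in> indep W E" "card (insert x S) = Suc r" "x \<notin> S"
      using f by (auto simp: chain_def)
    moreover from this have "finite S"
      using fin by (auto simp: indep_def)
    ultimately show ?thesis by (auto simp: indep_def pairwise_insert)
  qed (use z in \<open>auto simp: chain_def\<close>)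
  have "\<phi> S = 0" for S
  proof (rule harmonic_eq_0[OF W E deg large supp])
    show "boundary W \<phi> S = 0" if "S \<subseteq> W" for S
      unfolding \<phi>_def using that W by (simp add: boundary_diff cycle boundary_boundary)
    show "(\<Sum>x\<in>T. osign x (T - {x}) * \<phi> (T - {x})) = 0" if T: "T \<in> indep W E" for T
    proof (cases "card T = Suc r")
      case True
      then have TK: "T \<in> K" "T \<subseteq> W" using T by (auto simp: K_def indep_def)
      \<comment> \<open>The inner product of \<open>\<phi>\<close> with the boundary of the single
        face \<open>T\<close> is the coboundary of \<open>\<phi>\<close> at
        \<open>T\<close>.\<close>
      have "0 = (\<Sum>S\<in>Pow W. \<phi> S * b T S)"
        using a[OF TK(1)] by (simp add: \<phi>_def bd_f)
      also have "\<dots> = (\<Sum>S\<in>Pow W. \<Sum>x\<in>W - S. \<phi> S * (osign x S * of_bool (insert x S = T)))"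
        by (simp add: b_def boundary_def sum_distrib_left)
      also have "\<dots> = (\<Sum>U\<in>Pow W. \<Sum>x\<in>U. \<phi> (U - {x}) * (osign x (U - {x}) * of_bool (insert x (U - {x}) = T)))"
        by (rule sum_insert_pairs[OF W])
      also have "\<dots> = (\<Sum>U\<in>Pow W. if U = T then \<Sum>x\<in>T. osign x (T - {x}) * \<phi> (T - {x}) else 0)"
        by (intro sum.cong refl) (auto simp: insert_absorb mult.commute intro!: sum.neutral sum.cong)
      also have "\<dots> = (\<Sum>x\<in>T. osign x (T - {x}) * \<phi> (T - {x}))"
        using W TK by simp
      finally show ?thesis by simp
    next
      case False
      have "finite T" using T fin by (auto simp: indep_def)
      have "\<phi> (T - {x}) = 0" if "x \<in> T" for x
        using that False supp[of "T - {x}"] card_Suc_Diff1[OF \<open>finite T\<close> that] by auto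
      then show ?thesis by simp
    qed
  qed
  then show ?thesis
    using f that[of f] by (simp add: \<phi>_def)
qed

subsection \<open>Rainbow faces\<close>

definition rainbow :: "'v set \<Rightarrow> ('v \<Rightarrow> nat) \<Rightarrow> nat set \<Rightarrow> 'v set set" where
  "rainbow W col J = {T. T \<subseteq> W \<and> bij_betw col T J}"

text \<open>
  Exchanging \<open>x\<close> with the element of \<open>T\<close> of the same colour is a sign-reversing involution: no other
  element of \<open>T\<close> lies between the two in the order.
\<close>

lemma sum_rainbow_repeated_colour:
  fixes col :: "'v::linorder \<Rightarrow> nat"
  assumes W: "finite W" and col: "mono col"
  shows "(\<Sum>T\<in>rainbow W col J. \<Sum>x\<in>{x \<in> W - T. col x \<in> J}. osign x T * f (insert x T)) = 0"
proof -
  define D where "D = (SIGMA T:rainbow W col J. {x \<in> W - T. col x \<in> J})"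
  define h where "h = (\<lambda>(T, x). osign x T * f (insert x T))"
  \<comment> \<open>The element of \<open>T\<close> sharing the colour of \<open>x\<close>. The swap
    keeps the union \<open>insert x T\<close> and changes only which of the two equally coloured
    elements counts as added.\<close>
  define twin where "twin T x = inv_into T col (col x)" for T x
  define swp where "swp = (\<lambda>(T, x). (insert x (T - {twin T x}), twin T x))"
  have fR: "finite (rainbow W col J)"
    using W by (auto simp: rainbow_def intro: finite_subset[of _ "Pow W"])
  have swp: "swp q \<in> D \<and> swp (swp q) = q \<and> h (swp q) = - h q" if q: "q \<in> D" for q
  proof -
    obtain T x where qe: "q = (T, x)" and T: "T \<subseteq> W" "bij_betw col T J" and x: "x \<in> W - T" "col x \<in> J"
      using q by (auto simp: D_def rainbow_def)
    define y where "y = twin T x"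
    define \<eta> where "\<eta> = T - {y}"
    have im: "col ` T = J" and inj: "inj_on col T"
      using T by (auto simp: bij_betw_def)
    have y: "y \<in> T" "col y = col x"
      using x im by (auto simp: y_def twin_def intro: inv_into_into f_inv_into_f)
    have Te: "T = insert y \<eta>" and yn: "y \<notin> \<eta>" and xn: "x \<notin> \<eta>" and xy: "x \<noteq> y"
      using y x by (auto simp: \<eta>_def)
    have inj\<eta>: "inj_on col \<eta>" and c\<eta>: "col x \<notin> col ` \<eta>" and J: "J = insert (col x) (col ` \<eta>)"
      using inj im y yn unfolding Te by auto
    have bij': "bij_betw col (insert x \<eta>) J"
      using inj\<eta> c\<eta> J xn by (auto simp: bij_betw_def)
    have twin': "twin (insert x \<eta>) y = x"
      unfolding twin_def y(2) using bij' by (intro inv_into_f_f) (auto simp: bij_betw_def)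
    have sq: "swp q = (insert x \<eta>, y)"
      by (simp add: swp_def qe \<eta>_def y_def)
    have "finite \<eta>" using T W finite_subset by (auto simp: \<eta>_def)
    have "z < x \<longleftrightarrow> z < y" if "z \<in> \<eta>" for z
    proof -
      have "col z \<noteq> col x" using c\<eta> that by (metis imageI)
      then show ?thesis
        using y(2) monoD[OF col, of z x] monoD[OF col, of z y] monoD[OF col, of x z] monoD[OF col, of y z]
        by (metis le_antisym less_le_not_le linorder_le_less_linear)
    qed
    then have "osign x \<eta> = osign y \<eta>"
      unfolding osign_def by (metis (mono_tags, lifting) Collect_cong)
    then have "osign y (insert x \<eta>) = - osign x (insert y \<eta>)"
      using xn yn xy \<open>finite \<eta>\<close> by (auto simp: osign_insert)
    then have "h (swp q) = - h q"
      unfolding sq by (simp add: h_def qe Te insert_commute)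
    moreover have "swp q \<in> D"
      unfolding sq using T x y xy yn bij' by (auto simp: D_def rainbow_def \<eta>_def)
    moreover have "swp (swp q) = q"
      unfolding sq using twin' xn by (simp add: swp_def qe Te)
    ultimately show ?thesis by blast
  qed
  have "sum h D = (\<Sum>q\<in>D. - h q)"
    by (rule sum.reindex_bij_witness[where i = swp and j = swp]) (use swp in force)+
  then have "sum h D = 0" by (simp add: sum_negf)
  then show ?thesis
    using W fR by (simp add: sum.Sigma D_def h_def)
qed

text \<open>A rainbow set for \<open>insert i J\<close> has exactly one element of colour
  \<open>i\<close>, and removing it inverts the insertion.\<close>

lemma sum_rainbow_insert:
  fixes f :: "'v set \<Rightarrow> real"
  assumes W: "finite W" and i: "i \<notin> J"
  shows "(\<Sum>T\<in>rainbow W col J. \<Sum>x\<in>{x \<in> W. col x = i}. f (insert x T)) = (\<Sum>S\<in>rainbow W col (insert i J). f S)"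
proof -
  have fR: "finite (rainbow W col J)"
    using W by (auto simp: rainbow_def intro: finite_subset[of _ "Pow W"])
  let ?y = "\<lambda>S. inv_into S col i"
  have "(\<Sum>T\<in>rainbow W col J. \<Sum>x\<in>{x \<in> W. col x = i}. f (insert x T)) =
      (\<Sum>(T, x)\<in>rainbow W col J \<times> {x \<in> W. col x = i}. f (insert x T))"
    using W fR by (simp add: sum.cartesian_product)
  also have "\<dots> = (\<Sum>S\<in>rainbow W col (insert i J). f S)"
  proof (rule sum.reindex_bij_witness[where i = "\<lambda>S. (S - {?y S}, ?y S)" and j = "\<lambda>(T, x). insert x T"])
    fix S assume "S \<in> rainbow W col (insert i J)"
    then have S: "S \<subseteq> W" "inj_on col S" "col ` S = insert i J"
      by (auto simp: rainbow_def bij_betw_def)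
    have y: "?y S \<in> S" "col (?y S) = i"
      using S(3) by (auto intro: inv_into_into f_inv_into_f)
    have "col ` (S - {?y S}) = J"
      using S y i by (simp add: inj_on_image_set_diff[OF S(2)])
    then show "(S - {?y S}, ?y S) \<in> rainbow W col J \<times> {x \<in> W. col x = i}"
      using S y by (auto simp: rainbow_def bij_betw_def inj_on_diff)
    show "(case (S - {?y S}, ?y S) of (T, x) \<Rightarrow> insert x T) = S"
      using y by auto
  next
    fix q assume "q \<in> rainbow W col J \<times> {x \<in> W. col x = i}"
    then obtain T x where q: "q = (T, x)" and T: "T \<subseteq> W" "inj_on col T" "col ` T = J" and x: "x \<in> W" "col x = i"
      by (auto simp: rainbow_def bij_betw_def)
    have xT: "x \<notin> T" using T x i by auto
    have inj: "inj_on col (insert x T)" using T x i xT by auto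
    then have "?y (insert x T) = x"
      using x inv_into_f_f[OF inj, of x] by simp
    then show "(case case q of (T, x) \<Rightarrow> insert x T of S \<Rightarrow> (S - {?y S}, ?y S)) = q"
      using xT by (simp add: q)
    show "(case q of (T, x) \<Rightarrow> insert x T) \<in> rainbow W col (insert i J)"
      using inj T x by (auto simp: q rainbow_def bij_betw_def)
  qed (auto)
  finally show ?thesis .
qed

text \<open>A topological Hall theorem. The chains \<open>c I\<close> form a chain map from the
  augmented simplex on the colours to the complex, with \<open>c I\<close> using only colours in
  \<open>I\<close>; acyclicity permits its construction face by face. The total rainbow weight plays
  the role of a degree, as in Sperner's lemma.\<close>

lemma ex_rainbow_face:
  fixes col :: "'v::linorder \<Rightarrow> nat"
  assumes W: "finite W" and C: "finite C" and col: "mono col"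
    and F: "F \<subseteq> Pow W" "{} \<in> F"
    and acyclic: "\<And>I r z. I \<subseteq> C \<Longrightarrow> card I = Suc r \<Longrightarrow> chain {S \<in> F. col ` S \<subseteq> I} r z \<Longrightarrow>
      (\<And>S. S \<subseteq> W \<Longrightarrow> boundary W z S = 0) \<Longrightarrow>
      \<exists>f. chain {S \<in> F. col ` S \<subseteq> I} (Suc r) f \<and> (\<forall>S\<in>Pow W. boundary W f S = z S)"
  shows "\<exists>S\<in>F. bij_betw col S C"
proof -
  define FI where "FI I = {S \<in> F. col ` S \<subseteq> I}" for I
  define Q where "Q c I \<longleftrightarrow> chain (FI I) (card I) (c I) \<and>
    (\<forall>S\<in>Pow W. boundary W (c I) S = (\<Sum>i\<in>I. osign i (I - {i}) * c (I - {i}) S))" for c I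
  have fin: "finite I" if "I \<subseteq> C" for I using that C finite_subset by blast
  have "\<exists>c. c {} = (\<lambda>S. of_bool (S = {})) \<and> (\<forall>I\<subseteq>C. card I \<le> n \<longrightarrow> Q c I)" for n
  proof (induction n)
    case 0
    have "Q (\<lambda>_ S. of_bool (S = {})) {}"
      using F by (auto simp: Q_def FI_def chain_def boundary_def)
    then show ?case using fin by fastforce
  next
    case (Suc n)
    then obtain c where c0: "c {} = (\<lambda>S. of_bool (S = {}))"
      and c: "\<And>I. I \<subseteq> C \<Longrightarrow> card I \<le> n \<Longrightarrow> Q c I"
      by auto
    have "\<exists>f. chain (FI I) (Suc n) f \<and> (\<forall>S\<in>Pow W. boundary W f S = (\<Sum>i\<in>I. osign i (I - {i}) * c (I - {i}) S))"
      if I: "I \<subseteq> C" "card I = Suc n" for I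
    proof -
      have Q: "Q c (I - {i})" "card (I - {i}) = n" if "i \<in> I" for i
        using that I c[of "I - {i}"] fin[OF I(1)] by auto
      let ?z = "\<lambda>S. \<Sum>i\<in>I. osign i (I - {i}) * c (I - {i}) S"
      show ?thesis
        unfolding FI_def
      proof (rule acyclic[OF I, of ?z])
        show "chain {S \<in> F. col ` S \<subseteq> I} n ?z"
          unfolding chain_def
        proof (intro allI impI)
          fix S assume "?z S \<noteq> 0"
          then obtain i where "i \<in> I" "c (I - {i}) S \<noteq> 0"
            by (metis (no_types, lifting) mult_zero_right sum.neutral)
          then show "S \<in> {S \<in> F. col ` S \<subseteq> I} \<and> card S = n"
            using Q[of i] by (auto simp: Q_def chain_def FI_def)
        qed
        fix S assume S: "S \<subseteq> W"
        \<comment> \<open>The prescribed boundary must itself be a cycle: deleting two colours in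
          either order gives the same chain with opposite signs.\<close>
        have "boundary W ?z S = (\<Sum>i\<in>I. \<Sum>j\<in>I - {i}. osign i (I - {i}) * osign j (I - {i} - {j}) * c (I - {i} - {j}) S)"
          unfolding boundary_linear using Q S by (intro sum.cong refl) (simp add: Q_def sum_distrib_left mult.assoc)
        also have "\<dots> = 0"
        proof (rule sum_antisymmetric[OF fin[OF I(1)]])
          fix i j assume ij: "i \<in> I" "j \<in> I" "i \<noteq> j"
          then have "I - {i} = insert j (I - {i, j})" "I - {j} = insert i (I - {i, j})"
            "I - {i} - {j} = I - {i, j}" "I - {j} - {i} = I - {i, j}"
            by auto
          moreover have "osign i (insert j (I - {i, j})) * osign j (I - {i, j}) =
              - (osign j (insert i (I - {i, j})) * osign i (I - {i, j}))"
            using ij fin[OF I(1)] by (intro osign_anticommute) auto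
          ultimately show "osign i (I - {i}) * osign j (I - {i} - {j}) * c (I - {i} - {j}) S =
              - (osign j (I - {j}) * osign i (I - {j} - {i}) * c (I - {j} - {i}) S)"
            by simp
        qed
        finally show "boundary W ?z S = 0" .
      qed
    qed
    then have "\<forall>I\<in>{I. I \<subseteq> C \<and> card I = Suc n}. \<exists>f. chain (FI I) (Suc n) f \<and>
        (\<forall>S\<in>Pow W. boundary W f S = (\<Sum>i\<in>I. osign i (I - {i}) * c (I - {i}) S))"
      by blast
    from bchoice[OF this] obtain g where g: "\<And>I. I \<subseteq> C \<Longrightarrow> card I = Suc n \<Longrightarrow> chain (FI I) (Suc n) (g I) \<and>
        (\<forall>S\<in>Pow W. boundary W (g I) S = (\<Sum>i\<in>I. osign i (I - {i}) * c (I - {i}) S))"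
      by blast
    \<comment> \<open>Only sets of size \<open>Suc n\<close> get new values, so the facets
      \<open>I - {i}\<close> of sets of size at most \<open>Suc n\<close> keep their old
      chains.\<close>
    define c' where "c' I = (if card I = Suc n then g I else c I)" for I
    have "Q c' I" if I: "I \<subseteq> C" "card I \<le> Suc n" for I
    proof -
      have "c' (I - {i}) = c (I - {i})" if "i \<in> I" for i
        using that I card_Diff1_less[OF fin[OF I(1)] that] by (simp add: c'_def)
      then show ?thesis
        using I c[of I] g[of I] by (cases "card I = Suc n") (auto simp: Q_def c'_def)
    qed
    then show ?case using c0 by (intro exI[of _ c']) (simp add: c'_def[of "{}"])
  qed
  then obtain c where c0: "c {} = (\<lambda>S. of_bool (S = {}))" and c: "\<And>I. I \<subseteq> C \<Longrightarrow> Q c I"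
    using C by (metis card_mono)
  have supp: "S \<in> F \<and> col ` S \<subseteq> I" if "I \<subseteq> C" "c I S \<noteq> 0" for I S
    using c[OF that(1)] that(2) by (auto simp: Q_def chain_def FI_def)
  have "(\<Sum>S\<in>rainbow W col I. c I S) = 1" if "I \<subseteq> C" for I
    using fin[OF that] that
  \<comment> \<open>The new colour \<open>i\<close> is below all of \<open>J\<close>. As
    \<open>col\<close> is monotone, vertices of colour \<open>i\<close> precede those of a rainbow
    set for \<open>J\<close>, so all signs attached to \<open>i\<close> equal 1.\<close>
  proof (induction I rule: finite_linorder_min_induct)
    case empty
    have "rainbow W col {} = {{}}" by (auto simp: rainbow_def bij_betw_def)
    then show ?case by (simp add: c0)
  next
    case (insert i J)
    let ?I = "insert i J"
    have iJ: "i \<notin> J" using insert.hyps by auto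
    have diff_i: "?I - {i} = J" using iJ by auto
    have s0: "osign i J = 1"
    proof -
      have "{y \<in> J. y < i} = {}" using insert.hyps by force
      then show ?thesis by (simp only: osign_def card.empty power_0)
    qed
    have "1 = (\<Sum>T\<in>rainbow W col J. c J T)"
      using insert by simp
    also have "\<dots> = (\<Sum>T\<in>rainbow W col J. boundary W (c ?I) T)"
    proof (intro sum.cong refl)
      fix T assume "T \<in> rainbow W col J"
      then have T: "T \<subseteq> W" "col ` T = J" by (auto simp: rainbow_def bij_betw_def)
      \<comment> \<open>\<open>T\<close> shows every colour of \<open>J\<close>, whereas
        \<open>c (?I - {j})\<close> lives on faces avoiding the colour \<open>j\<close>; only the
        facet \<open>J\<close> survives.\<close>
      have "c (?I - {j}) T = 0" if "j \<in> J" for j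
      proof (rule ccontr)
        assume "c (?I - {j}) T \<noteq> 0"
        then have "col ` T \<subseteq> ?I - {j}" using supp[of "?I - {j}" T] insert.prems by blast
        then show False using that T by auto
      qed
      then have "(\<Sum>j\<in>?I. osign j (?I - {j}) * c (?I - {j}) T) = c J T"
        using insert.hyps iJ by (simp add: diff_i s0 del: insert_Diff_if insert_Diff)
      then show "c J T = boundary W (c ?I) T"
        using c[OF insert.prems] T by (simp add: Q_def)
    qed
    \<comment> \<open>An added vertex has colour \<open>i\<close> and completes a rainbow set, or
      repeats a colour of \<open>J\<close> and cancels in the total, or has a colour outside
      \<open>?I\<close>, where \<open>c ?I\<close> vanishes.\<close>
    also have "\<dots> = (\<Sum>T\<in>rainbow W col J. (\<Sum>x\<in>{x \<in> W. col x = i}. c ?I (insert x T)) +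
        (\<Sum>x\<in>{x \<in> W - T. col x \<in> J}. osign x T * c ?I (insert x T)))"
    proof (intro sum.cong refl)
      fix T assume "T \<in> rainbow W col J"
      then have T: "T \<subseteq> W" "col ` T = J" by (auto simp: rainbow_def bij_betw_def)
      let ?g = "\<lambda>x. osign x T * c ?I (insert x T)"
      have "boundary W (c ?I) T = sum ?g ({x \<in> W. col x = i} \<union> {x \<in> W - T. col x \<in> J})"
        unfolding boundary_def
      proof (rule sum.mono_neutral_right)
        show "\<forall>x\<in>W - T - ({x \<in> W. col x = i} \<union> {x \<in> W - T. col x \<in> J}). ?g x = 0"
          using supp[OF insert.prems] by fastforce
      qed (use W T iJ in auto)
      also have "\<dots> = sum ?g {x \<in> W. col x = i} + sum ?g {x \<in> W - T. col x \<in> J}"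
        using W iJ by (intro sum.union_disjoint) auto
      also have "sum ?g {x \<in> W. col x = i} = (\<Sum>x\<in>{x \<in> W. col x = i}. c ?I (insert x T))"
      proof (intro sum.cong refl)
        fix x assume x: "x \<in> {x \<in> W. col x = i}"
        have "\<not> y < x" if "y \<in> T" for y
        proof -
          have "col x < col y" using x T that insert.hyps by auto
          then show ?thesis using monoD[OF col, of y x] by (metis leD less_imp_le)
        qed
        then have "{y \<in> T. y < x} = {}" by auto
        then show "?g x = c ?I (insert x T)" by (simp only: osign_def card.empty power_0 mult_1)
      qed
      finally show "boundary W (c ?I) T = (\<Sum>x\<in>{x \<in> W. col x = i}. c ?I (insert x T)) + sum ?g {x \<in> W - T. col x \<in> J}" .
    qed
    also have "\<dots> = (\<Sum>S\<in>rainbow W col ?I. c ?I S)"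
      by (simp only: sum.distrib sum_rainbow_insert[OF W iJ] sum_rainbow_repeated_colour[OF W col] add_0_right)
    finally show ?case by simp
  qed
  from this[of C] obtain S where "S \<in> rainbow W col C" "c C S \<noteq> 0"
    by (metis order_refl sum.neutral zero_neq_one)
  then show ?thesis
    using supp[of C S] by (auto simp: rainbow_def)
qed

section \<open>Degrees in the union and the disjoint representatives\<close>

text \<open>The recursion uses one boundary operator on all vertices, while acyclicity is proved on
  the vertices of the selected colours; a chain supported there does not see the difference.\<close>

lemma boundary_restrict:
  assumes "finite W" "W' \<subseteq> W" "\<And>S. f S \<noteq> 0 \<Longrightarrow> S \<subseteq> W'"
  shows "boundary W f S = boundary W' f S"
  unfolding boundary_def using assms by (intro sum.mono_neutral_right) fastforce+

lemma degree_multi_union: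
  assumes "\<And>i. i \<in> {1..m} \<Longrightarrow> finite (H i)"
  shows "deg (multi_union m H) v = (\<Sum>i\<in>{1..m}. card {e \<in> H i. v \<in> e})"
proof -
  have "size (filter_mset P (\<Sum>i\<in>A. mset_set (H i))) = (\<Sum>i\<in>A. card {e \<in> H i. P e})"
    if "finite A" "\<And>i. i \<in> A \<Longrightarrow> finite (H i)" for A P
    using that by (induction A rule: finite_induct) auto
  then show ?thesis
    using assms unfolding deg_def multi_union_def by blast
qed

lemma degree_le_max_degree:
  assumes "v \<in> V"
  shows "deg M v \<le> max_degree V M"
  unfolding max_degree_def
proof (rule Max_ge)
  have "deg M ` V \<subseteq> {..size M}"
    by (auto simp: deg_def intro: size_mset_mono)
  then show "finite (deg M ` V)" using finite_subset by blast
qed (use assms in simp)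

theorem theorem3p3:
  fixes k m :: nat and V :: "'a set" and H :: "nat \<Rightarrow> 'a set set"
  assumes "k \<ge> 1" and "m \<ge> 1"
    and "\<And>i. i \<in> {1..m} \<Longrightarrow> hypergraph V (H i)"
    and "\<And>i. i \<in> {1..m} \<Longrightarrow> uniform k (H i)"
    and "\<And>i. i \<in> {1..m} \<Longrightarrow> finite (H i)"
    and "\<And>i. i \<in> {1..m} \<Longrightarrow> H i \<noteq> {}"
    and "\<And>i. i \<in> {1..m} \<Longrightarrow> card (H i) \<ge> k * max_degree V (multi_union m H)"
  shows "\<exists>f. is_SJR m H f"
proof -
  define D where "D = max_degree V (multi_union m H)"
  have "\<exists>g. bij_betw g {0..<card (H i)} (H i)" if "i \<in> {1..m}" for i
    using ex_bij_betw_nat_finite assms(5)[OF that] by blast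
  then obtain g where g: "\<And>i. i \<in> {1..m} \<Longrightarrow> bij_betw (g i) {0..<card (H i)} (H i)"
    by metis
  \<comment> \<open>Edges are coded by their index in an enumeration of \<open>H i\<close>. An edge
    occurring in several \<open>H i\<close> gives several vertices, and the lexicographic order
    makes the colour \<open>fst\<close> monotone although \<open>'a\<close> carries no
    order.\<close>
  define W where "W = (SIGMA i:{1..m}. {0..<card (H i)})"
  define E where "E = (\<lambda>(i, t). g i t)"
  have W: "finite W" by (simp add: W_def)
  have E_in: "E x \<in> H (fst x)" if "x \<in> W" for x
    using that bij_betwE[OF g, of "fst x"] by (auto simp: W_def E_def)
  have E: "finite (E x) \<and> card (E x) = k" if "x \<in> W" for x
    using E_in[OF that] assms(4)[of "fst x"] that by (auto simp: W_def uniform_def)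
  have deg_E: "card {x \<in> W. w \<in> E x} \<le> D" for w
  proof (cases "w \<in> V")
    case True
    have "{x \<in> W. w \<in> E x} = (SIGMA i:{1..m}. {t \<in> {0..<card (H i)}. w \<in> g i t})"
      by (auto simp: W_def E_def)
    then have "card {x \<in> W. w \<in> E x} = (\<Sum>i\<in>{1..m}. card {t \<in> {0..<card (H i)}. w \<in> g i t})"
      by simp
    also have "\<dots> = (\<Sum>i\<in>{1..m}. card {e \<in> H i. w \<in> e})"
    proof (intro sum.cong refl)
      fix i assume i: "i \<in> {1..m}"
      have "bij_betw (g i) {t \<in> {0..<card (H i)}. w \<in> g i t} {e \<in> H i. w \<in> e}"
        using bij_betw_imp_surj_on[OF g[OF i]] by (intro bij_betw_subset[OF g[OF i]]) blast+
      then show "card {t \<in> {0..<card (H i)}. w \<in> g i t} = card {e \<in> H i. w \<in> e}"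
        by (rule bij_betw_same_card)
    qed
    also have "\<dots> = deg (multi_union m H) w"
      by (intro degree_multi_union[symmetric] assms(5))
    also have "\<dots> \<le> D"
      unfolding D_def using True by (rule degree_le_max_degree)
    finally show ?thesis .
  next
    \<comment> \<open>The maximum degree ranges over \<open>V\<close> only; a point outside
      \<open>V\<close> lies in no edge.\<close>
    case False
    then have "{x \<in> W. w \<in> E x} = {}"
      using E_in assms(3) by (fastforce simp: W_def hypergraph_def)
    then show ?thesis by (simp only: card.empty)
  qed
  \<comment> \<open>Positivity of \<open>k * D\<close> turns the bound by \<open>Suc r\<close>
    colour classes of size at least \<open>k * D\<close> into the strict inequality
    \<open>r * k * D < card WI\<close>.\<close>
  have "D \<ge> 1"
  proof -
    have 1: "1 \<in> {1..m}" using assms(2) by simp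
    obtain e where e: "e \<in> H 1" using assms(6)[OF 1] by blast
    obtain w where w: "w \<in> e"
      using e assms(3)[OF 1] unfolding hypergraph_def by blast
    have "e \<in> g 1 ` {0..<card (H 1)}"
      using e bij_betw_imp_surj_on[OF g[OF 1]] by simp
    then obtain t where t: "e = g 1 t" "t \<in> {0..<card (H 1)}" by (rule imageE)
    have "(1, t) \<in> {x \<in> W. w \<in> E x}"
      using 1 w t by (auto simp: W_def E_def)
    then have "card {x \<in> W. w \<in> E x} \<noteq> 0"
      using W by (subst card_0_eq) auto
    then show ?thesis using deg_E[of w] by linarith
  qed

  have "\<exists>S\<in>indep W E. bij_betw fst S {1..m}"
  proof (rule ex_rainbow_face[OF W])
    show "mono (fst :: nat \<times> nat \<Rightarrow> nat)"
      by (auto simp: mono_def less_eq_prod_def)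
    show "indep W E \<subseteq> Pow W" "{} \<in> indep W E"
      by (auto simp: indep_def)
    fix I r z
    assume I: "I \<subseteq> {1..m}" "card I = Suc r"
      and z: "chain {S \<in> indep W E. fst ` S \<subseteq> I} r z" and cycle: "\<And>S. S \<subseteq> W \<Longrightarrow> boundary W z S = 0"
    define WI where "WI = {x \<in> W. fst x \<in> I}"
    have WI: "WI \<subseteq> W" "finite WI" using W by (auto simp: WI_def)
    \<comment> \<open>The faces with colours in \<open>I\<close> are again an independence complex,
      now on \<open>WI\<close>, so the vanishing result applies to it.\<close>
    have faces: "{S \<in> indep W E. fst ` S \<subseteq> I} = indep WI E"
      by (auto simp: indep_def WI_def)
    have restrict: "boundary W f S = boundary WI f S" if "chain (indep WI E) n f" for f n S
      using that by (intro boundary_restrict W WI) (auto simp: chain_def indep_def)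
    have large: "r * k * D < card WI"
    proof -
      have "r * k * D < Suc r * (k * D)"
        using \<open>D \<ge> 1\<close> assms(1) by simp
      also have "\<dots> = (\<Sum>i\<in>I. k * D)" using I by simp
      also have "\<dots> \<le> (\<Sum>i\<in>I. card (H i))"
        using I assms(7) by (intro sum_mono) (auto simp: D_def)
      also have "\<dots> = card (SIGMA i:I. {0..<card (H i)})"
        using finite_subset[OF I(1)] by simp
      also have "(SIGMA i:I. {0..<card (H i)}) = WI"
        using I by (auto simp: WI_def W_def)
      finally show ?thesis .
    qed
    have deg_WI: "card {x \<in> WI. w \<in> E x} \<le> D" for w
      using deg_E[of w] card_mono[of "{x \<in> W. w \<in> E x}" "{x \<in> WI. w \<in> E x}"] W WI(1) by fastforce
    obtain f where "chain (indep WI E) (Suc r) f" "\<And>S. boundary WI f S = z S"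
    proof (rule acyclic_indep[OF WI(2) _ deg_WI large])
      show "chain (indep WI E) r z" using z by (simp add: faces)
      then show "boundary WI z S = 0" if "S \<subseteq> WI" for S
        using cycle[of S] that WI(1) restrict by fastforce
    qed (use E WI(1) in auto)
    then show "\<exists>f. chain {S \<in> indep W E. fst ` S \<subseteq> I} (Suc r) f \<and> (\<forall>S\<in>Pow W. boundary W f S = z S)"
      unfolding faces using restrict by metis
  qed simp
  then obtain S where S: "S \<in> indep W E" "bij_betw fst S {1..m}" by blast
  define x where "x = inv_into S fst"
  have x: "x i \<in> S" "fst (x i) = i" if "i \<in> {1..m}" for i
    using S(2) that by (auto simp: x_def bij_betw_def intro: inv_into_into f_inv_into_f)
  have "E (x i) \<in> H i" if "i \<in> {1..m}" for i
    using E_in[of "x i"] x[OF that] S(1) by (auto simp: indep_def)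
  moreover have "E (x i) \<inter> E (x j) = {}" if "i \<in> {1..m}" "j \<in> {1..m}" "i \<noteq> j" for i j
  proof -
    have "x i \<noteq> x j" using x that by metis
    then show ?thesis
      using S(1) x that unfolding indep_def pairwise_def disjnt_def by blast
  qed
  ultimately show ?thesis
    by (intro exI[of _ "\<lambda>i. E (x i)"]) (auto simp: is_SJR_def)
qed

end
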